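(* Suppose that $\mathbb{E}_{\boldsymbol{\Delta}}[\mathcal{Q}_\ell(F_\ell-F_{\ell-1})]=\mathbb{E}[F_\ell-F_{\ell-1}]$ for all $0\le\ell\le L$, and that there are nonnegative constants $\alpha,\alpha',\beta,\beta',\gamma,\lambda$ (with $\lambda>0$) such that for all $0\le \ell\le L$ \begin{itemize} \item[(M1)] $\big|\mathbb{E}[F_L-F]\big|\lesssim h_L^{\alpha}+s_L^{-\alpha'}$, \item[(M2)] $\mathbb{V}_{\boldsymbol{\Delta}}[\mathcal{Q}_\ell(F_\ell-F_{\ell-1})]\lesssim R_\ell^{-1}N_\ell^{-1/\lambda}\big(h_{\ell-1}^{\beta}+(1-\delta_{s_\ell,s_{\ell-1}})\,s_{\ell-1}^{-\beta'}\big)$, \item[(M3)] $\mathrm{cost}(\mathcal{Q}_\ell(F_\ell-F_{\ell-1}))\lesssim R_\ell N_\ell\big(s_\ell h_\ell^{-d}+h_\ell^{-\gamma}\big)$, \end{itemize} where $\delta_{\cdot,\cdot}$ is the Kronecker delta. Then $$e\big(\mathcal{Q}^{\mathrm{ML}}_L(F)\big)^2\lesssim h_L^{2\alpha}+s_L^{-2\alpha'}+\sum_{\ell=0}^L R_\ell^{-1}N_\ell^{-1/\lambda}\big(h_{\ell-1}^{\beta}+(1-\delta_{s_\ell,s_{\ell-1}})\,s_{\ell-1}^{-\beta'}\big)$$ and $$\mathrm{cost}\big(\mathcal{Q}^{\mathrm{ML}}_L(F)\big)\lesssim\sum_{\ell=0}^L R_\ell N_\ell\big(s_\ell h_\ell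^{-d}+h_\ell^{-\gamma}\big).$$
   Context: Let $d\in\{1,2,3\}$. $F$ is an integrable real random variable (quantity of interest). For $\ell=0,\dots,L$ let $h_0>h_1>\dots>h_L>0$ be mesh widths, $s_0\le s_1\le\dots\le s_L$ positive integers (truncation dimensions), and $F_\ell=F_{h_\ell,s_\ell}$ an approximation of $F$ which is a function of $s_\ell$ i.i.d. standard Gaussian variables. Conventions: $F_{-1}:=0$, $h_{-1}:=1$, $s_{-1}:=1$. For positive integers $N_\ell,R_\ell$, the level-$\ell$ estimator of $\mathbb{E}[F_\ell-F_{\ell-1}]$ is the randomly shifted lattice rule $$\mathcal{Q}_\ell(F_\ell-F_{\ell-1})=\frac1{R_\ell}\sum_{k=1}^{R_\ell}\frac1{N_\ell}\sum_{i=1}^{N_\ell}\big(F_\ell(\boldsymbol{y}_\ell^{(i,k)})-F_{\ell-1}(\boldsymbol{y}_\ell^{(i,k)})\big),\qquad \boldsymbol{y}_\ell^{(i,k)}=\boldsymbol{\Phi}_{s_\ell}^{-1}\big(\mathrm{frac}(i\boldsymbol{z}_\ell/N_\ell+\boldsymbol{\Delta}_{\ell,k})\big),$$ where $\boldsymbol{z}_\ell\in\mathbb{N}^{s_\ell}$ is a fixed generating vector, $\mathrm{frac}$ is the componentwise fractional part, $\boldsymbol{\Phi}_{s}^{-1}$ is the inverse standard normal distribution function applied componentwise, and the shifts $\boldsymbol{\Delta}_{\ell,k}$ are uniformly distributed on $[0,1]^{s_\ell}$ and all mutually independent (over $k$ and over $\ell$). ($F_{\ell-1}$ depends only on the first $s_{\ell-1}$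 components.) $\mathbb{E}_{\boldsymbol{\Delta}}$ denotes expectation over the random shifts, and $\mathbb{V}_{\boldsymbol{\Delta}}[\mathcal{Q}_\ell(F_\ell-F_{\ell-1})]:=\mathbb{E}_{\boldsymbol{\Delta}}\big[(\mathcal{Q}_\ell(F_\ell-F_{\ell-1})-\mathbb{E}[F_\ell-F_{\ell-1}])^2\big]$. The multilevel estimator is $\mathcal{Q}^{\mathrm{ML}}_L(F):=\sum_{\ell=0}^L\mathcal{Q}_\ell(F_\ell-F_{\ell-1})$, its root mean square error is $e(\mathcal{Q}^{\mathrm{ML}}_L(F)):=\big(\mathbb{E}_{\boldsymbol{\Delta}}[(\mathcal{Q}^{\mathrm{ML}}_L(F)-\mathbb{E}[F])^2]\big)^{1/2}$, and its cost is the sum of the (nonnegative) level costs, $\mathrm{cost}(\mathcal{Q}^{\mathrm{ML}}_L(F)):=\sum_{\ell=0}^L\mathrm{cost}(\mathcal{Q}_\ell(F_\ell-F_{\ell-1}))$. $A\lesssim B$ means $A\le cB$ for a constant $c>0$ independent of $\ell$, $L$ and of all $h_\ell,s_\ell,N_\ell,R_\ell$. *)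

theory Defs
  imports "HOL-Probability.Probability"
begin

text \<open>
  A discretisation collects everything the implied constants must not depend on: the number of
  levels, the mesh widths, truncation dimensions, numbers of lattice points and of random shifts,
  the generating vectors, the random shifts with the probability space carrying them, and the costs
  of the level estimators. A bound with an implied constant is a bound with one constant for all
  members of a set of discretisations. A vector of dimension \<open>s\<close> is an element of
  \<open>{..<s} \<rightarrow>\<^sub>E UNIV\<close>; its components are numbered from 0.
\<close>

record 'b discretisation =
  top_level :: nat
  mesh_width :: "nat \<Rightarrow> real"
  trunc_dim :: "nat \<Rightarrow> nat"
  num_points :: "nat \<Rightarrow> nat"
  num_shifts :: "nat \<Rightarrow> nat"
  gen_vector :: "nat \<Rightarrow> nat \<Rightarrow> nat"
  shift_space :: "'b measure"
  shift :: "nat \<Rightarrow> nat \<Rightarrow> 'b \<Rightarrow> nat \<Rightarrow> real"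
  level_cost :: "nat \<Rightarrow> real"

definition valid_discretisation :: "'b discretisation \<Rightarrow> bool" where
  "valid_discretisation p \<longleftrightarrow>
     (\<forall>l<top_level p. mesh_width p (Suc l) < mesh_width p l) \<and>
     0 < mesh_width p (top_level p) \<and>
     (\<forall>l<top_level p. trunc_dim p l \<le> trunc_dim p (Suc l)) \<and>
     (\<forall>l\<le>top_level p. 0 < trunc_dim p l \<and> 0 < num_points p l \<and> 0 < num_shifts p l
        \<and> 0 \<le> level_cost p l) \<and>
     prob_space (shift_space p) \<and>
     prob_space.indep_vars (shift_space p)
       (\<lambda>(l, k). \<Pi>\<^sub>M j\<in>{..<trunc_dim p l}. borel) (\<lambda>(l, k). shift p l k)
       (SIGMA l:{..top_level p}. {1..num_shifts p l}) \<and>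
     (\<forall>l\<le>top_level p. \<forall>k\<in>{1..num_shifts p l}.
        distr (shift_space p) (\<Pi>\<^sub>M j\<in>{..<trunc_dim p l}. borel) (shift p l k) =
        (\<Pi>\<^sub>M j\<in>{..<trunc_dim p l}. uniform_measure lborel {0..1}))"

definition prev_mesh_width :: "'b discretisation \<Rightarrow> nat \<Rightarrow> real" where
  "prev_mesh_width p l = (if l = 0 then 1 else mesh_width p (l - 1))"

definition prev_trunc_dim :: "'b discretisation \<Rightarrow> nat \<Rightarrow> nat" where
  "prev_trunc_dim p l = (if l = 0 then 1 else trunc_dim p (l - 1))"

text \<open>
  \<open>A h s\<close> is the approximation with mesh width \<open>h\<close> and truncation dimension \<open>s\<close>, as a function
  of an \<open>s\<close>-dimensional vector. In \<open>approx\<close> the vector \<open>y\<close> may be longer (or infinite): only its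
  first components are used.
\<close>

definition approx ::
  "(real \<Rightarrow> nat \<Rightarrow> (nat \<Rightarrow> real) \<Rightarrow> real) \<Rightarrow> 'b discretisation \<Rightarrow> nat \<Rightarrow> (nat \<Rightarrow> real) \<Rightarrow> real" where
  "approx A p l y = A (mesh_width p l) (trunc_dim p l) (restrict y {..<trunc_dim p l})"

definition approx_diff ::
  "(real \<Rightarrow> nat \<Rightarrow> (nat \<Rightarrow> real) \<Rightarrow> real) \<Rightarrow> 'b discretisation \<Rightarrow> nat \<Rightarrow> (nat \<Rightarrow> real) \<Rightarrow> real" where
  "approx_diff A p l y = approx A p l y - (if l = 0 then 0 else approx A p (l - 1) y)"

definition std_normal_quantile :: "real \<Rightarrow> real" where
  \<comment> \<open>The value outside \<open>{0<..<1}\<close> is unspecified; below, the argument 0 occurs with probability 0.\<close>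
  "std_normal_quantile = inv (cdf std_normal_distribution)"

definition lattice_point :: "'b discretisation \<Rightarrow> nat \<Rightarrow> nat \<Rightarrow> nat \<Rightarrow> 'b \<Rightarrow> nat \<Rightarrow> real" where
  "lattice_point p l i k \<theta> = (\<lambda>j\<in>{..<trunc_dim p l}.
     std_normal_quantile
       (frac (real i * real (gen_vector p l j) / real (num_points p l) + shift p l k \<theta> j)))"

definition level_estimator ::
  "(real \<Rightarrow> nat \<Rightarrow> (nat \<Rightarrow> real) \<Rightarrow> real) \<Rightarrow> 'b discretisation \<Rightarrow> nat \<Rightarrow> 'b \<Rightarrow> real" where
  "level_estimator A p l \<theta> =
     1 / real (num_shifts p l) * (\<Sum>k = 1..num_shifts p l.
       1 / real (num_points p l) * (\<Sum>i = 1..num_points p l.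
         approx_diff A p l (lattice_point p l i k \<theta>)))"

definition ml_estimator ::
  "(real \<Rightarrow> nat \<Rightarrow> (nat \<Rightarrow> real) \<Rightarrow> real) \<Rightarrow> 'b discretisation \<Rightarrow> 'b \<Rightarrow> real" where
  "ml_estimator A p \<theta> = (\<Sum>l = 0..top_level p. level_estimator A p l \<theta>)"

definition ml_cost :: "'b discretisation \<Rightarrow> real" where
  "ml_cost p = (\<Sum>l = 0..top_level p. level_cost p l)"

text \<open>
  Mean square deviation of an estimator from a target value \<open>m\<close> over the random shifts. It takes
  values in \<open>[0, \<infinity>]\<close>, so an upper bound entails square integrability. With
  \<open>m\<close> the expectation of the level difference it is the variance of a level estimator.
\<close>

definition mean_square_dev :: "'b discretisation \<Rightarrow> ('b \<Rightarrow> real) \<Rightarrow> real \<Rightarrow> ennreal" where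
  "mean_square_dev p Q m = (\<integral>\<^sup>+ \<theta>. ennreal ((Q \<theta> - m)\<^sup>2) \<partial>shift_space p)"

definition ennreal_sqrt :: "ennreal \<Rightarrow> ennreal" where
  "ennreal_sqrt x = (if x = \<top> then \<top> else ennreal (sqrt (enn2real x)))"

definition expected_diff ::
  "'a measure \<Rightarrow> (nat \<Rightarrow> 'a \<Rightarrow> real) \<Rightarrow> (real \<Rightarrow> nat \<Rightarrow> (nat \<Rightarrow> real) \<Rightarrow> real) \<Rightarrow>
   'b discretisation \<Rightarrow> nat \<Rightarrow> real" where
  "expected_diff M Y A p l = (\<integral>\<omega>. approx_diff A p l (\<lambda>j. Y j \<omega>) \<partial>M)"

definition level_variance ::
  "'a measure \<Rightarrow> (nat \<Rightarrow> 'a \<Rightarrow> real) \<Rightarrow> (real \<Rightarrow> nat \<Rightarrow> (nat \<Rightarrow> real) \<Rightarrow> real) \<Rightarrow>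
   'b discretisation \<Rightarrow> nat \<Rightarrow> ennreal" where
  "level_variance M Y A p l =
     mean_square_dev p (level_estimator A p l) (expected_diff M Y A p l)"

definition ml_rmse ::
  "'a measure \<Rightarrow> ('a \<Rightarrow> real) \<Rightarrow> (real \<Rightarrow> nat \<Rightarrow> (nat \<Rightarrow> real) \<Rightarrow> real) \<Rightarrow>
   'b discretisation \<Rightarrow> ennreal" where
  "ml_rmse M F A p = ennreal_sqrt (mean_square_dev p (ml_estimator A p) (\<integral>\<omega>. F \<omega> \<partial>M))"

definition variance_rate :: "real \<Rightarrow> real \<Rightarrow> real \<Rightarrow> 'b discretisation \<Rightarrow> nat \<Rightarrow> real" where
  "variance_rate \<beta> \<beta>' lam p l =
     1 / real (num_shifts p l) * real (num_points p l) powr (- 1 / lam) *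
     (prev_mesh_width p l powr \<beta> +
      (1 - (if trunc_dim p l = prev_trunc_dim p l then 1 else 0)) *
        real (prev_trunc_dim p l) powr (- \<beta>'))"

definition cost_rate :: "nat \<Rightarrow> real \<Rightarrow> 'b discretisation \<Rightarrow> nat \<Rightarrow> real" where
  "cost_rate d \<gamma> p l =
     real (num_shifts p l) * real (num_points p l) *
     (real (trunc_dim p l) * mesh_width p l powr (- real d) + mesh_width p l powr (- \<gamma>))"

end

theory Submission
  imports Defs
begin

text \<open>
  Unbiasedness of the level estimators makes the bias of the multilevel estimator telescope to
  \<open>\<bbbE>[F\<^sub>L - F]\<close>. Estimators on different levels are functions of disjoint families of independent
  shifts, so the mean square error is exactly the squared bias plus the sum of the level variances.
  The first is bounded by (M1) and \<open>(a + b)\<^sup>2 \<le> 2 (a\<^sup>2 + b\<^sup>2)\<close>, the second by (M2).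
\<close>

lemma mono_on_range_inv:
  fixes f :: "'a::linorder \<Rightarrow> 'b::linorder"
  assumes "mono f"
  shows "mono_on (range f) (inv f)"
proof (rule mono_onI)
  fix u v assume "u \<in> range f" "v \<in> range f" "u \<le> v"
  show "inv f u \<le> inv f v"
  proof (cases "u = v")
    case False
    then have "f (inv f u) < f (inv f v)"
      using \<open>u \<in> range f\<close> \<open>v \<in> range f\<close> \<open>u \<le> v\<close> by (simp add: f_inv_into_f)
    then show ?thesis
      by (rule mono_invE[OF assms])
  qed simp
qed

lemma inv_eq_inv_if_notin_range:
  assumes "u \<notin> range f" "v \<notin> range f"
  shows "inv f u = inv f v"
proof -
  \<comment> \<open>Both predicates are empty, so \<open>SOME\<close> picks the same junk value for them.\<close>
  have "(\<lambda>x. f x = u) = (\<lambda>x. f x = v)"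
    using assms by auto
  then show ?thesis
    by (simp add: inv_def)
qed

lemma borel_measurable_inv_mono:
  fixes f :: "real \<Rightarrow> real"
  assumes "mono f" "range f \<in> sets borel"
  shows "inv f \<in> borel_measurable borel"
proof (rule borel_measurable_piecewise_mono)
  show "mono_on C (inv f)" if "C \<in> {range f, - range f}" for C
    using that
  proof (elim insertE emptyE)
    assume "C = range f"
    then show ?thesis
      using mono_on_range_inv[OF \<open>mono f\<close>] by simp
  next
    assume "C = - range f"
    then show ?thesis
      by (auto intro!: mono_onI eq_refl inv_eq_inv_if_notin_range)
  qed
qed (use \<open>range f \<in> sets borel\<close> in auto)

lemma (in finite_borel_measure) borel_measurable_inv_cdf:
  assumes "\<And>x. measure M {x} = 0"
  shows "inv (cdf M) \<in> borel_measurable borel"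
proof (rule borel_measurable_inv_mono)
  show "mono (cdf M)"
    by (simp add: cdf_nondecreasing monoI)
  have "continuous_on UNIV (cdf M)"
    using assms by (simp add: isCont_cdf continuous_at_imp_continuous_on)
  then have "connected (range (cdf M))"
    by (rule connected_continuous_image) simp
  then show "range (cdf M) \<in> sets borel"
    by (simp add: real_interval_borel_measurable is_interval_connected_1)
qed

lemma borel_measurable_std_normal_quantile [measurable]:
  "std_normal_quantile \<in> borel_measurable borel"
proof -
  interpret real_distribution std_normal_distribution
    by (rule real_dist_normal_dist)
  have "emeasure std_normal_distribution {x} = 0" for x
    by (subst emeasure_density)
       (auto intro!: nn_integral_0_iff_AE[THEN iffD2] AE_lborel_singleton[THEN AE_mp])
  then show ?thesis
    unfolding std_normal_quantile_def by (intro borel_measurable_inv_cdf) (simp add: measure_def)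
qed

lemma borel_measurable_frac [measurable]: "(frac :: real \<Rightarrow> real) \<in> borel_measurable borel"
  unfolding frac_def[abs_def] by measurable

lemma (in finite_measure) integrable_power2_diff_const_iff:
  fixes X :: "'a \<Rightarrow> real"
  assumes "X \<in> borel_measurable M"
  shows "integrable M (\<lambda>x. (X x - c)\<^sup>2) \<longleftrightarrow> integrable M (\<lambda>x. (X x)\<^sup>2)"
proof -
  have shift: "integrable M (\<lambda>x. (Z x - a)\<^sup>2)"
    if "Z \<in> borel_measurable M" "integrable M (\<lambda>x. (Z x)\<^sup>2)" for Z :: "'a \<Rightarrow> real" and a
    using that square_integrable_imp_integrable[OF that] by (simp add: power2_diff)
  show ?thesis
    using shift[of "\<lambda>x. X x - c" "- c"] shift[of X c] assms by auto
qed

lemma (in prob_space) expectation_power2_diff_const: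
  fixes X :: "'a \<Rightarrow> real"
  assumes "integrable M X" "integrable M (\<lambda>x. (X x)\<^sup>2)"
  shows "expectation (\<lambda>x. (X x - c)\<^sup>2) = variance X + (expectation X - c)\<^sup>2"
  using assms by (simp add: variance_eq prob_space power2_diff flip: power2_eq_square)

lemma integral_power2_sum_orthogonal:
  fixes X :: "'i \<Rightarrow> 'a \<Rightarrow> real"
  assumes "finite I"
    and integrable: "\<And>i j. i \<in> I \<Longrightarrow> j \<in> I \<Longrightarrow> integrable M (\<lambda>x. X i x * X j x)"
    and orthogonal: "\<And>i j. i \<in> I \<Longrightarrow> j \<in> I \<Longrightarrow> i \<noteq> j \<Longrightarrow> (\<integral>x. X i x * X j x \<partial>M) = 0"
  shows "(\<integral>x. (\<Sum>i\<in>I. X i x)\<^sup>2 \<partial>M) = (\<Sum>i\<in>I. \<integral>x. (X i x)\<^sup>2 \<partial>M)"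
proof -
  have "(\<integral>x. (\<Sum>i\<in>I. X i x)\<^sup>2 \<partial>M) = (\<integral>x. (\<Sum>i\<in>I. \<Sum>j\<in>I. X i x * X j x) \<partial>M)"
    by (simp add: power2_eq_square sum_product)
  also have "\<dots> = (\<Sum>i\<in>I. \<Sum>j\<in>I. \<integral>x. X i x * X j x \<partial>M)"
    using integrable by (simp add: Bochner_Integration.integral_sum)
  also have "\<dots> = (\<Sum>i\<in>I. \<Sum>j\<in>I. if i = j then \<integral>x. (X i x)\<^sup>2 \<partial>M else 0)"
    using orthogonal by (intro sum.cong) (auto simp: power2_eq_square)
  also have "\<dots> = (\<Sum>i\<in>I. \<integral>x. (X i x)\<^sup>2 \<partial>M)"
    using \<open>finite I\<close> by simp
  finally show ?thesis .
qed

lemma (in prob_space) indep_vars_imp_indep_var: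
  assumes "indep_vars (\<lambda>_. N) X I" "i \<in> I" "j \<in> I" "i \<noteq> j"
  shows "indep_var N (X i) N (X j)"
proof -
  have "indep_var N ((\<lambda>y. y i) \<circ> (\<lambda>x. \<lambda>k\<in>{i}. X k x)) N ((\<lambda>y. y j) \<circ> (\<lambda>x. \<lambda>k\<in>{j}. X k x))"
    by (rule indep_var_compose[OF indep_var_restrict[OF assms(1)]]) (use assms in auto)
  then show ?thesis
    by (simp add: comp_def)
qed

lemma integrable_power2_sum:
  fixes f :: "'i \<Rightarrow> 'a \<Rightarrow> real"
  assumes "\<And>i. i \<in> I \<Longrightarrow> f i \<in> borel_measurable M"
    and "\<And>i. i \<in> I \<Longrightarrow> integrable M (\<lambda>x. (f i x)\<^sup>2)"
  shows "integrable M (\<lambda>x. (\<Sum>i\<in>I. f i x)\<^sup>2)"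
proof (rule Bochner_Integration.integrable_bound)
  show "integrable M (\<lambda>x. (\<Sum>i\<in>I. (f i x)\<^sup>2) * real (card I))"
    using assms(2) by (intro integrable_mult_left Bochner_Integration.integrable_sum)
  show "(\<lambda>x. (\<Sum>i\<in>I. f i x)\<^sup>2) \<in> borel_measurable M"
    using assms(1) by (intro borel_measurable_power borel_measurable_sum)
  show "AE x in M. norm ((\<Sum>i\<in>I. f i x)\<^sup>2) \<le> norm ((\<Sum>i\<in>I. (f i x)\<^sup>2) * real (card I))"
    using sum_squared_le_sum_of_squares[of _ I] by (simp add: sum_nonneg)
qed

lemma (in prob_space) variance_sum_indep_vars:
  fixes X :: "'i \<Rightarrow> 'a \<Rightarrow> real"
  assumes "finite I"
    and indep: "indep_vars (\<lambda>_. borel) X I"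
    and square_integrable: "\<And>i. i \<in> I \<Longrightarrow> integrable M (\<lambda>x. (X i x)\<^sup>2)"
  shows "variance (\<lambda>x. \<Sum>i\<in>I. X i x) = (\<Sum>i\<in>I. variance (X i))"
proof -
  define Z where "Z i x = X i x - expectation (X i)" for i x
  have measurable: "X i \<in> borel_measurable M" if "i \<in> I" for i
    using indep that by (simp add: indep_vars_def)
  have integrable: "integrable M (X i)" if "i \<in> I" for i
    using that measurable square_integrable by (blast intro: square_integrable_imp_integrable)
  have centered: "integrable M (Z i)" "expectation (Z i) = 0" if "i \<in> I" for i
    using integrable[OF that] by (simp_all add: Z_def[abs_def] prob_space)
  have "indep_vars (\<lambda>_. borel) Z I"
    unfolding Z_def[abs_def] by (rule indep_vars_compose2[OF indep]) simp
  then have indep_Z: "indep_var borel (Z i) borel (Z j)" if "i \<in> I" "j \<in> I" "i \<noteq> j" for i j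
    using that by (rule indep_vars_imp_indep_var)
  have "variance (\<lambda>x. \<Sum>i\<in>I. X i x) = expectation (\<lambda>x. (\<Sum>i\<in>I. Z i x)\<^sup>2)"
    using integrable by (simp add: Z_def Bochner_Integration.integral_sum sum_subtractf)
  also have "\<dots> = (\<Sum>i\<in>I. expectation (\<lambda>x. (Z i x)\<^sup>2))"
  proof (rule integral_power2_sum_orthogonal[OF \<open>finite I\<close>])
    fix i j assume "i \<in> I" "j \<in> I"
    show "integrable M (\<lambda>x. Z i x * Z j x)"
    proof (cases "i = j")
      case True
      then show ?thesis
        using \<open>i \<in> I\<close> measurable square_integrable
        by (simp add: Z_def integrable_power2_diff_const_iff flip: power2_eq_square)
    next
      case False
      then show ?thesis
        using \<open>i \<in> I\<close> \<open>j \<in> I\<close> by (intro indep_var_integrable indep_Z centered)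
    qed
    show "expectation (\<lambda>x. Z i x * Z j x) = 0" if "i \<noteq> j"
      using that \<open>i \<in> I\<close> \<open>j \<in> I\<close> by (simp add: indep_var_lebesgue_integral indep_Z centered)
  qed
  finally show ?thesis
    by (simp add: Z_def)
qed

lemma (in prob_space) indep_vars_sum_Sigma:
  fixes X :: "'i \<times> 'j \<Rightarrow> 'a \<Rightarrow> 'b::{second_countable_topology, topological_comm_monoid_add}"
  assumes "indep_vars (\<lambda>_. borel) X (SIGMA i:I. J i)"
  shows "indep_vars (\<lambda>_. borel) (\<lambda>i x. \<Sum>j\<in>J i. X (i, j) x) I"
proof -
  have "indep_vars (\<lambda>i. PiM ({i} \<times> J i) (\<lambda>_. borel)) (\<lambda>i x. \<lambda>k\<in>{i} \<times> J i. X k x) I"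
    using assms by (rule indep_vars_restrict) (auto simp: disjoint_family_on_def)
  then have "indep_vars (\<lambda>_. borel) (\<lambda>i x. \<Sum>j\<in>J i. (\<lambda>k\<in>{i} \<times> J i. X k x) (i, j)) I"
    by (rule indep_vars_compose2[where Y = "\<lambda>i y. \<Sum>j\<in>J i. y (i, j)"])
       (auto intro!: borel_measurable_sum measurable_component_singleton)
  then show ?thesis
    by simp
qed

lemma ennreal_sqrt_power2: "(ennreal_sqrt x)\<^sup>2 = x"
  by (cases x) (simp_all add: ennreal_sqrt_def ennreal_power power2_eq_square ennreal_top_mult
    flip: ennreal_mult)

lemma integrable_power2_if_mean_square_dev_finite:
  assumes "finite_measure (shift_space p)" "Q \<in> borel_measurable (shift_space p)"
    and "mean_square_dev p Q m < \<top>"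
  shows "integrable (shift_space p) (\<lambda>\<theta>. (Q \<theta>)\<^sup>2)"
proof -
  have "integrable (shift_space p) (\<lambda>\<theta>. (Q \<theta> - m)\<^sup>2)"
    using assms(2,3) by (intro integrableI_nonneg) (simp_all add: mean_square_dev_def)
  then show ?thesis
    using assms(1,2) by (simp add: finite_measure.integrable_power2_diff_const_iff)
qed

lemma mean_square_dev_eq_variance_add_bias:
  assumes "prob_space (shift_space p)" "Q \<in> borel_measurable (shift_space p)"
    and "integrable (shift_space p) (\<lambda>\<theta>. (Q \<theta>)\<^sup>2)"
  shows "mean_square_dev p Q r =
    ennreal (prob_space.variance (shift_space p) Q) +
    ennreal (((\<integral>\<theta>. Q \<theta> \<partial>shift_space p) - r)\<^sup>2)"
proof -
  interpret prob_space "shift_space p"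
    by fact
  have "mean_square_dev p Q r = ennreal (expectation (\<lambda>\<theta>. (Q \<theta> - r)\<^sup>2))"
    unfolding mean_square_dev_def using assms(2,3)
    by (intro nn_integral_eq_integral) (simp_all add: integrable_power2_diff_const_iff)
  also have "expectation (\<lambda>\<theta>. (Q \<theta> - r)\<^sup>2) = variance Q + (expectation Q - r)\<^sup>2"
    using square_integrable_imp_integrable[OF assms(2,3)] assms(3)
    by (rule expectation_power2_diff_const)
  finally show ?thesis
    by simp
qed

lemma mean_square_dev_sum_indep_vars:
  assumes "prob_space (shift_space p)" "finite I"
    and indep: "prob_space.indep_vars (shift_space p) (\<lambda>_. borel) Q I"
    and mean: "\<And>i. i \<in> I \<Longrightarrow> (\<integral>\<theta>. Q i \<theta> \<partial>shift_space p) = m i"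
    and finite_dev: "\<And>i. i \<in> I \<Longrightarrow> mean_square_dev p (Q i) (m i) < \<top>"
  shows "mean_square_dev p (\<lambda>\<theta>. \<Sum>i\<in>I. Q i \<theta>) r =
    (\<Sum>i\<in>I. mean_square_dev p (Q i) (m i)) + ennreal (((\<Sum>i\<in>I. m i) - r)\<^sup>2)"
proof -
  interpret prob_space "shift_space p"
    by fact
  have measurable: "Q i \<in> borel_measurable (shift_space p)" if "i \<in> I" for i
    using indep that by (simp add: indep_vars_def)
  have square_integrable: "integrable (shift_space p) (\<lambda>\<theta>. (Q i \<theta>)\<^sup>2)" if "i \<in> I" for i
    using measurable finite_dev that finite_measure_axioms
    by (blast intro: integrable_power2_if_mean_square_dev_finite)
  have integrable: "integrable (shift_space p) (Q i)" if "i \<in> I" for i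
    using that measurable square_integrable by (blast intro: square_integrable_imp_integrable)
  have level: "mean_square_dev p (Q i) (m i) = ennreal (variance (Q i))" if "i \<in> I" for i
    using that measurable square_integrable mean prob_space_axioms
    by (simp add: mean_square_dev_eq_variance_add_bias)
  have "mean_square_dev p (\<lambda>\<theta>. \<Sum>i\<in>I. Q i \<theta>) r =
      ennreal (variance (\<lambda>\<theta>. \<Sum>i\<in>I. Q i \<theta>)) +
      ennreal ((expectation (\<lambda>\<theta>. \<Sum>i\<in>I. Q i \<theta>) - r)\<^sup>2)"
    using measurable square_integrable prob_space_axioms
    by (intro mean_square_dev_eq_variance_add_bias borel_measurable_sum integrable_power2_sum)
  also have "variance (\<lambda>\<theta>. \<Sum>i\<in>I. Q i \<theta>) = (\<Sum>i\<in>I. variance (Q i))"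
    using \<open>finite I\<close> indep square_integrable by (rule variance_sum_indep_vars)
  also have "ennreal \<dots> = (\<Sum>i\<in>I. mean_square_dev p (Q i) (m i))"
    by (simp add: level variance_positive flip: sum_ennreal)
  also have "expectation (\<lambda>\<theta>. \<Sum>i\<in>I. Q i \<theta>) = (\<Sum>i\<in>I. m i)"
    using integrable mean by (simp add: Bochner_Integration.integral_sum)
  finally show ?thesis .
qed

lemma sum_expected_diff:
  assumes "\<And>l. l \<le> L \<Longrightarrow> integrable M (\<lambda>\<omega>. approx A p l (\<lambda>j. Y j \<omega>))"
  shows "(\<Sum>l = 0..L. expected_diff M Y A p l) = (\<integral>\<omega>. approx A p L (\<lambda>j. Y j \<omega>) \<partial>M)"
  using assms by (induction L) (simp_all add: expected_diff_def approx_diff_def)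

lemma trunc_dim_diff_one_le:
  assumes "valid_discretisation p" "l \<le> top_level p"
  shows "trunc_dim p (l - 1) \<le> trunc_dim p l"
  using assms by (cases l) (auto simp: valid_discretisation_def)

lemma borel_measurable_approx:
  assumes "A (mesh_width p l) (trunc_dim p l) \<in> borel_measurable (\<Pi>\<^sub>M j\<in>{..<trunc_dim p l}. borel)"
    and "trunc_dim p l \<le> s"
  shows "approx A p l \<in> borel_measurable (\<Pi>\<^sub>M j\<in>{..<s}. borel)"
  unfolding approx_def
  by (rule measurable_compose[OF measurable_restrict_subset assms(1)]) (use assms(2) in auto)

lemma borel_measurable_approx_diff:
  assumes valid: "valid_discretisation p" and level: "l \<le> top_level p"
    and A: "\<And>l. l \<le> top_level p \<Longrightarrow>
      A (mesh_width p l) (trunc_dim p l) \<in> borel_measurable (\<Pi>\<^sub>M j\<in>{..<trunc_dim p l}. borel)"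
  shows "approx_diff A p l \<in> borel_measurable (\<Pi>\<^sub>M j\<in>{..<trunc_dim p l}. borel)"
proof -
  have "approx A p l \<in> borel_measurable (\<Pi>\<^sub>M j\<in>{..<trunc_dim p l}. borel)"
    using A[OF level] by (rule borel_measurable_approx) simp
  moreover have "approx A p (l - 1) \<in> borel_measurable (\<Pi>\<^sub>M j\<in>{..<trunc_dim p l}. borel)"
    using level trunc_dim_diff_one_le[OF valid level] by (intro borel_measurable_approx A) simp_all
  ultimately show ?thesis
    unfolding approx_diff_def by (cases "l = 0") simp_all
qed

definition lattice_rule ::
  "(real \<Rightarrow> nat \<Rightarrow> (nat \<Rightarrow> real) \<Rightarrow> real) \<Rightarrow> 'b discretisation \<Rightarrow> nat \<Rightarrow> (nat \<Rightarrow> real) \<Rightarrow> real" where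
  "lattice_rule A p l x =
     1 / real (num_points p l) * (\<Sum>i = 1..num_points p l.
       approx_diff A p l (\<lambda>j\<in>{..<trunc_dim p l}. std_normal_quantile
         (frac (real i * real (gen_vector p l j) / real (num_points p l) + x j))))"

lemma level_estimator_eq_sum_lattice_rule:
  "level_estimator A p l \<theta> =
     1 / real (num_shifts p l) * (\<Sum>k = 1..num_shifts p l. lattice_rule A p l (shift p l k \<theta>))"
  by (simp add: level_estimator_def lattice_point_def lattice_rule_def)

lemma borel_measurable_lattice_rule:
  assumes "approx_diff A p l \<in> borel_measurable (\<Pi>\<^sub>M j\<in>{..<trunc_dim p l}. borel)"
  shows "lattice_rule A p l \<in> borel_measurable (\<Pi>\<^sub>M j\<in>{..<trunc_dim p l}. borel)"
proof -
  have "(\<lambda>x. \<lambda>j\<in>{..<trunc_dim p l}. std_normal_quantile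
        (frac (real i * real (gen_vector p l j) / real (num_points p l) + x j)))
      \<in> (\<Pi>\<^sub>M j\<in>{..<trunc_dim p l}. borel) \<rightarrow>\<^sub>M (\<Pi>\<^sub>M j\<in>{..<trunc_dim p l}. borel)" for i
    by measurable
  from measurable_compose[OF this assms] show ?thesis
    unfolding lattice_rule_def
    by (intro borel_measurable_times borel_measurable_const borel_measurable_sum)
qed

lemma indep_vars_level_estimator:
  assumes valid: "valid_discretisation p"
    and A: "\<And>l. l \<le> top_level p \<Longrightarrow>
      A (mesh_width p l) (trunc_dim p l) \<in> borel_measurable (\<Pi>\<^sub>M j\<in>{..<trunc_dim p l}. borel)"
  shows "prob_space.indep_vars (shift_space p) (\<lambda>_. borel) (level_estimator A p) {0..top_level p}"
proof -
  interpret prob_space "shift_space p"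
    using valid by (simp add: valid_discretisation_def)
  have "indep_vars (\<lambda>(l, k). \<Pi>\<^sub>M j\<in>{..<trunc_dim p l}. borel) (\<lambda>(l, k). shift p l k)
      (SIGMA l:{0..top_level p}. {1..num_shifts p l})"
    using valid by (simp add: valid_discretisation_def atLeast0AtMost)
  then have "indep_vars (\<lambda>_. borel)
      (\<lambda>i \<theta>. (case i of (l, k) \<Rightarrow> lattice_rule A p l) ((case i of (l, k) \<Rightarrow> shift p l k) \<theta>))
      (SIGMA l:{0..top_level p}. {1..num_shifts p l})"
    by (rule indep_vars_compose2)
       (auto intro!: borel_measurable_lattice_rule borel_measurable_approx_diff[OF valid _ A])
  from indep_vars_sum_Sigma[OF this]
  have "indep_vars (\<lambda>_. borel)
      (\<lambda>l \<theta>. \<Sum>k = 1..num_shifts p l. lattice_rule A p l (shift p l k \<theta>)) {0..top_level p}"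
    by simp
  then have "indep_vars (\<lambda>_. borel)
      (\<lambda>l \<theta>. 1 / real (num_shifts p l) *
        (\<Sum>k = 1..num_shifts p l. lattice_rule A p l (shift p l k \<theta>))) {0..top_level p}"
    by (rule indep_vars_compose2) simp
  then show ?thesis
    by (simp add: level_estimator_eq_sum_lattice_rule[abs_def])
qed

lemma ml_rmse_power2_eq:
  assumes valid: "valid_discretisation p" and F: "integrable M F"
    and A_measurable: "\<And>l. l \<le> top_level p \<Longrightarrow>
      A (mesh_width p l) (trunc_dim p l) \<in> borel_measurable (\<Pi>\<^sub>M j\<in>{..<trunc_dim p l}. borel)"
    and A_integrable: "\<And>l. l \<le> top_level p \<Longrightarrow>
      integrable M (\<lambda>\<omega>. approx A p l (\<lambda>j. Y j \<omega>))"
    and unbiased: "\<And>l. l \<le> top_level p \<Longrightarrow>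
      (\<integral>\<theta>. level_estimator A p l \<theta> \<partial>shift_space p) = expected_diff M Y A p l"
    and finite_variance: "\<And>l. l \<le> top_level p \<Longrightarrow> level_variance M Y A p l < \<top>"
  shows "(ml_rmse M F A p)\<^sup>2 = (\<Sum>l = 0..top_level p. level_variance M Y A p l) +
    ennreal ((\<integral>\<omega>. approx A p (top_level p) (\<lambda>j. Y j \<omega>) - F \<omega> \<partial>M)\<^sup>2)"
proof -
  have "(ml_rmse M F A p)\<^sup>2 =
      mean_square_dev p (\<lambda>\<theta>. \<Sum>l = 0..top_level p. level_estimator A p l \<theta>) (\<integral>\<omega>. F \<omega> \<partial>M)"
    by (simp add: ml_rmse_def ennreal_sqrt_power2 ml_estimator_def[abs_def])
  also have "\<dots> = (\<Sum>l = 0..top_level p. level_variance M Y A p l) +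
      ennreal (((\<Sum>l = 0..top_level p. expected_diff M Y A p l) - (\<integral>\<omega>. F \<omega> \<partial>M))\<^sup>2)"
    unfolding level_variance_def
  proof (rule mean_square_dev_sum_indep_vars)
    show "prob_space (shift_space p)"
      using valid by (simp add: valid_discretisation_def)
    show "prob_space.indep_vars (shift_space p) (\<lambda>_. borel) (level_estimator A p) {0..top_level p}"
      using valid A_measurable by (rule indep_vars_level_estimator)
  qed (use unbiased finite_variance in \<open>simp_all add: level_variance_def\<close>)
  also have "(\<Sum>l = 0..top_level p. expected_diff M Y A p l) - (\<integral>\<omega>. F \<omega> \<partial>M) =
      (\<integral>\<omega>. approx A p (top_level p) (\<lambda>j. Y j \<omega>) - F \<omega> \<partial>M)"
    using A_integrable F by (simp add: sum_expected_diff)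
  finally show ?thesis .
qed

lemma sum_add_power2_bias_le:
  fixes b c c' x y :: real and V :: "'i \<Rightarrow> ennreal" and v :: "'i \<Rightarrow> real"
  assumes bias: "\<bar>b\<bar> \<le> c * (x + y)"
    and var: "\<And>i. i \<in> I \<Longrightarrow> V i \<le> ennreal (c' * v i)"
    and nonneg: "\<And>i. i \<in> I \<Longrightarrow> 0 \<le> v i" "0 \<le> c'"
  shows "(\<Sum>i\<in>I. V i) + ennreal (b\<^sup>2) \<le> ennreal ((2 * c\<^sup>2 + c') * (x\<^sup>2 + y\<^sup>2 + (\<Sum>i\<in>I. v i)))"
proof -
  have "b\<^sup>2 \<le> (c * (x + y))\<^sup>2"
    using power_mono[OF bias, of 2] by simp
  also have "\<dots> = c\<^sup>2 * (x + y)\<^sup>2"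
    by (rule power_mult_distrib)
  also have "\<dots> \<le> c\<^sup>2 * (2 * (x\<^sup>2 + y\<^sup>2))"
    using sum_squares_bound[of x y] by (intro mult_left_mono) (simp_all add: power2_sum)
  finally have square_bias: "b\<^sup>2 \<le> 2 * c\<^sup>2 * (x\<^sup>2 + y\<^sup>2)"
    by (simp add: algebra_simps)
  have sum_nonneg: "0 \<le> (\<Sum>i\<in>I. v i)"
    using nonneg(1) by (rule sum_nonneg)
  have "(\<Sum>i\<in>I. V i) + ennreal (b\<^sup>2) \<le> (\<Sum>i\<in>I. ennreal (c' * v i)) + ennreal (b\<^sup>2)"
    using var by (intro add_right_mono sum_mono)
  also have "\<dots> = ennreal (c' * (\<Sum>i\<in>I. v i) + b\<^sup>2)"
    using nonneg sum_nonneg by (simp flip: sum_distrib_left)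
  also have "\<dots> \<le> ennreal ((2 * c\<^sup>2 + c') * (x\<^sup>2 + y\<^sup>2 + (\<Sum>i\<in>I. v i)))"
  proof (rule ennreal_leI)
    have "0 \<le> c' * (x\<^sup>2 + y\<^sup>2) + 2 * c\<^sup>2 * (\<Sum>i\<in>I. v i)"
      using nonneg(2) sum_nonneg by simp
    then show "c' * (\<Sum>i\<in>I. v i) + b\<^sup>2 \<le> (2 * c\<^sup>2 + c') * (x\<^sup>2 + y\<^sup>2 + (\<Sum>i\<in>I. v i))"
      using square_bias by (simp add: algebra_simps)
  qed
  finally show ?thesis .
qed

lemma variance_rate_nonneg: "0 \<le> variance_rate \<beta> \<beta>' lam p l"
  by (simp add: variance_rate_def)

lemma powr_power2: "(x powr a)\<^sup>2 = x powr (2 * a)" for x a :: real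
  by (simp add: power2_eq_square flip: powr_add)

theorem theorem1:
  fixes M :: "'a measure" and F :: "'a \<Rightarrow> real" and Y :: "nat \<Rightarrow> 'a \<Rightarrow> real"
    and A :: "real \<Rightarrow> nat \<Rightarrow> (nat \<Rightarrow> real) \<Rightarrow> real"
    and P :: "'b discretisation set"
    and d :: nat and \<alpha> \<alpha>' \<beta> \<beta>' \<gamma> lam :: real
  assumes d: "d \<in> {1, 2, 3}"
    and prob: "prob_space M"
    and F: "integrable M F"
    and valid: "\<And>p. p \<in> P \<Longrightarrow> valid_discretisation p"
    and Y_indep: "\<And>p. p \<in> P \<Longrightarrow>
      prob_space.indep_vars M (\<lambda>_. borel) Y {..<trunc_dim p (top_level p)}"
    and Y_normal: "\<And>p j. p \<in> P \<Longrightarrow> j < trunc_dim p (top_level p) \<Longrightarrow>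
      distributed M lborel (Y j) std_normal_density"
    and A_measurable: "\<And>p l. p \<in> P \<Longrightarrow> l \<le> top_level p \<Longrightarrow>
      A (mesh_width p l) (trunc_dim p l) \<in> borel_measurable (\<Pi>\<^sub>M j\<in>{..<trunc_dim p l}. borel)"
    and A_integrable: "\<And>p l. p \<in> P \<Longrightarrow> l \<le> top_level p \<Longrightarrow>
      integrable M (\<lambda>\<omega>. approx A p l (\<lambda>j. Y j \<omega>))"
    and unbiased: "\<And>p l. p \<in> P \<Longrightarrow> l \<le> top_level p \<Longrightarrow>
      (\<integral>\<theta>. level_estimator A p l \<theta> \<partial>shift_space p) = expected_diff M Y A p l"
    and nonneg: "0 \<le> \<alpha>" "0 \<le> \<alpha>'" "0 \<le> \<beta>" "0 \<le> \<beta>'" "0 \<le> \<gamma>" "0 < lam"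
    and M1: "\<exists>c>0. \<forall>p\<in>P.
      \<bar>\<integral>\<omega>. approx A p (top_level p) (\<lambda>j. Y j \<omega>) - F \<omega> \<partial>M\<bar>
        \<le> c * (mesh_width p (top_level p) powr \<alpha> + real (trunc_dim p (top_level p)) powr (- \<alpha>'))"
    and M2: "\<exists>c>0. \<forall>p\<in>P. \<forall>l\<le>top_level p.
      level_variance M Y A p l \<le> ennreal (c * variance_rate \<beta> \<beta>' lam p l)"
    and M3: "\<exists>c>0. \<forall>p\<in>P. \<forall>l\<le>top_level p.
      level_cost p l \<le> c * cost_rate d \<gamma> p l"
  shows "(\<exists>c>0. \<forall>p\<in>P.
      (ml_rmse M F A p)\<^sup>2
        \<le> ennreal (c * (mesh_width p (top_level p) powr (2 * \<alpha>)
            + real (trunc_dim p (top_level p)) powr (- 2 * \<alpha>')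
            + (\<Sum>l = 0..top_level p. variance_rate \<beta> \<beta>' lam p l)))) \<and>
    (\<exists>c>0. \<forall>p\<in>P.
      ml_cost p \<le> c * (\<Sum>l = 0..top_level p. cost_rate d \<gamma> p l))"
proof -
  obtain c\<^sub>1 where bias: "\<And>p. p \<in> P \<Longrightarrow>
      \<bar>\<integral>\<omega>. approx A p (top_level p) (\<lambda>j. Y j \<omega>) - F \<omega> \<partial>M\<bar>
        \<le> c\<^sub>1 * (mesh_width p (top_level p) powr \<alpha> + real (trunc_dim p (top_level p)) powr (- \<alpha>'))"
    using M1 by blast
  obtain c\<^sub>2 where "0 < c\<^sub>2" and variance: "\<And>p l. p \<in> P \<Longrightarrow> l \<le> top_level p \<Longrightarrow>
      level_variance M Y A p l \<le> ennreal (c\<^sub>2 * variance_rate \<beta> \<beta>' lam p l)"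
    using M2 by blast
  have "(ml_rmse M F A p)\<^sup>2 \<le> ennreal ((2 * c\<^sub>1\<^sup>2 + c\<^sub>2) *
      (mesh_width p (top_level p) powr (2 * \<alpha>) + real (trunc_dim p (top_level p)) powr (- 2 * \<alpha>')
        + (\<Sum>l = 0..top_level p. variance_rate \<beta> \<beta>' lam p l)))" if p: "p \<in> P" for p
  proof -
    have "level_variance M Y A p l < \<top>" if "l \<le> top_level p" for l
      using variance[OF p that] ennreal_less_top by (rule le_less_trans)
    note ml_rmse_power2_eq[OF valid[OF p] F A_measurable[OF p] A_integrable[OF p] unbiased[OF p] this]
    also note sum_add_power2_bias_le[OF bias[OF p] variance[OF p] variance_rate_nonneg]
    finally show ?thesis
      using \<open>0 < c\<^sub>2\<close> by (simp add: powr_power2)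
  qed
  moreover have "0 < 2 * c\<^sub>1\<^sup>2 + c\<^sub>2"
    using \<open>0 < c\<^sub>2\<close> by (simp add: add_nonneg_pos)
  moreover have "\<exists>c>0. \<forall>p\<in>P. ml_cost p \<le> c * (\<Sum>l = 0..top_level p. cost_rate d \<gamma> p l)"
    using M3 unfolding ml_cost_def sum_distrib_left by (meson atLeastAtMost_iff sum_mono)
  ultimately show ?thesis
    by blast
qed

end
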